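(* Let $G=(V,E)$ be a connected bipartite graph with $n=|V|\ge2$ and let $p>1$. Let $\lambda_1\le\dots\le\lambda_n$ be the variational eigenvalues of the $p$-Laplacian $\Delta_p$ of $G$. Then there are no eigenvalues of $\Delta_p$ between the largest and the second largest variational eigenvalues, i.e. no eigenvalue $\lambda$ with $\lambda_{n-1}<\lambda<\lambda_n$.
   Context: Setting. $G=(V,E)$ is a finite simple undirected graph with edge measure $w:E\to(0,\infty)$, vertex weight $\mu:V\to(0,\infty)$ and potential $\kappa:V\to\mathbb R$ (values $w_{xy},\mu_x,\kappa_x$; $x\sim y$ means $\{x,y\}\in E$). Put $\Phi_p(t)=|t|^{p-2}t$ for $t\neq0$ and $\Phi_p(0)=0$. For $p>1$ the (unsigned, i.e. signature $\equiv+1$) $p$-Laplacian is $\Delta_p f(x)=\sum_{y\sim x}w_{xy}\Phi_p(f(x)-f(y))+\kappa_x\Phi_p(f(x))$, and a nonzero $f:V\to\mathbb R$ is an eigenfunction with eigenvalue $\lambda\in\mathbb R$ if $\Delta_p f(x)=\lambda\mu_x\Phi_p(f(x))$ for all $x\in V$. Variational eigenvalues. $\mathcal S_p=\{f\in\mathbb R^V:\sum_x\mu_x|f(x)|^p=1\}$. For a compact set $S=-S$ its index (Krasnoselskii genus) $\gamma(S)$ is $0$ if $S=\emptyset$, otherwise the least positive integer $k$ for which an odd continuous map $S\to\mathbb R^k\setminus\{0\}$ exists ($\infty$ if none). $\mathcal F_k(\mathcal S_p)$ is the family of compact $A=-A\subset\mathcal S_p$ with $\gamma(A)\ge k$. With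 $\mathcal R_p(f)=\frac{\sum_{\{x,y\}\in E}w_{xy}|f(x)-f(y)|^p+\sum_{x\in V}\kappa_x|f(x)|^p}{\sum_{x\in V}\mu_x|f(x)|^p}$, the variational eigenvalues are $\lambda_k=\inf_{S\in\mathcal F_k(\mathcal S_p)}\sup_{f\in S}\mathcal R_p(f)$, $k=1,\dots,n$. *)

theory Defs
  imports "HOL-Analysis.Analysis"
begin

text \<open>
  The vertex set is a finite type \<open>'v\<close>, so that \<open>\<real>\<^sup>V\<close> is \<^typ>\<open>real ^ 'v\<close> with its usual
  topology.  Edges are two-element sets of vertices; an edge measure is a function on sets of
  vertices of which only the values on edges are ever used.
\<close>

definition simple_graph :: "'v set set \<Rightarrow> bool" where
  "simple_graph E \<longleftrightarrow> (\<forall>e\<in>E. card e = 2)"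

definition connected_graph :: "'v set set \<Rightarrow> bool" where
  "connected_graph E \<longleftrightarrow> (\<forall>x y. (x, y) \<in> {(u, v). {u, v} \<in> E}\<^sup>*)"

definition bipartite_graph :: "'v set set \<Rightarrow> bool" where
  "bipartite_graph E \<longleftrightarrow>
     (\<exists>A B. A \<union> B = UNIV \<and> A \<inter> B = {} \<and> (\<forall>e\<in>E. \<exists>a\<in>A. \<exists>b\<in>B. e = {a, b}))"

text \<open>The case distinction at \<open>0\<close> is not needed, because \<open>0 powr a = 0\<close> in HOL, but it makes
  the convention visible.\<close>

definition Phi :: "real \<Rightarrow> real \<Rightarrow> real" where
  "Phi p t = (if t = 0 then 0 else \<bar>t\<bar> powr (p - 2) * t)"

definition p_laplacian ::
  "real \<Rightarrow> 'v::finite set set \<Rightarrow> ('v set \<Rightarrow> real) \<Rightarrow> ('v \<Rightarrow> real) \<Rightarrow> real ^ 'v \<Rightarrow> 'v \<Rightarrow> real" where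
  "p_laplacian p E w \<kappa> f x =
     (\<Sum>y | {x, y} \<in> E. w {x, y} * Phi p (f $ x - f $ y)) + \<kappa> x * Phi p (f $ x)"

definition is_eigenfunction ::
  "real \<Rightarrow> 'v::finite set set \<Rightarrow> ('v set \<Rightarrow> real) \<Rightarrow> ('v \<Rightarrow> real) \<Rightarrow> ('v \<Rightarrow> real) \<Rightarrow>
   real \<Rightarrow> real ^ 'v \<Rightarrow> bool" where
  "is_eigenfunction p E w \<mu> \<kappa> lam f \<longleftrightarrow>
     f \<noteq> 0 \<and> (\<forall>x. p_laplacian p E w \<kappa> f x = lam * \<mu> x * Phi p (f $ x))"

definition is_eigenvalue ::
  "real \<Rightarrow> 'v::finite set set \<Rightarrow> ('v set \<Rightarrow> real) \<Rightarrow> ('v \<Rightarrow> real) \<Rightarrow> ('v \<Rightarrow> real) \<Rightarrow>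
   real \<Rightarrow> bool" where
  "is_eigenvalue p E w \<mu> \<kappa> lam \<longleftrightarrow> (\<exists>f. is_eigenfunction p E w \<mu> \<kappa> lam f)"

text \<open>\<open>\<bar>f x - f y\<bar>\<close> for the unordered pair \<open>e = {x, y}\<close>; see \<open>edge_diff_doubleton\<close> below.\<close>

definition edge_diff :: "real ^ 'v::finite \<Rightarrow> 'v set \<Rightarrow> real" where
  "edge_diff f e = (THE d. \<exists>x y. e = {x, y} \<and> d = \<bar>f $ x - f $ y\<bar>)"

lemma edge_diff_doubleton: "edge_diff f {x, y} = \<bar>f $ x - f $ y\<bar>"
  unfolding edge_diff_def
  by (rule the_equality) (auto simp: doubleton_eq_iff abs_minus_commute)

definition rayleigh ::
  "real \<Rightarrow> 'v::finite set set \<Rightarrow> ('v set \<Rightarrow> real) \<Rightarrow> ('v \<Rightarrow> real) \<Rightarrow> ('v \<Rightarrow> real) \<Rightarrow>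
   real ^ 'v \<Rightarrow> real" where
  "rayleigh p E w \<mu> \<kappa> f =
     ((\<Sum>e\<in>E. w e * edge_diff f e powr p) + (\<Sum>x\<in>UNIV. \<kappa> x * \<bar>f $ x\<bar> powr p))
     / (\<Sum>x\<in>UNIV. \<mu> x * \<bar>f $ x\<bar> powr p)"

definition p_sphere :: "real \<Rightarrow> ('v::finite \<Rightarrow> real) \<Rightarrow> (real ^ 'v) set" where
  "p_sphere p \<mu> = {f. (\<Sum>x\<in>UNIV. \<mu> x * \<bar>f $ x\<bar> powr p) = 1}"

text \<open>
  \<^term>\<open>Euclidean_space k\<close> is \<open>\<real>\<^sup>k\<close> as a topology on the sequences that vanish from index \<open>k\<close> on,
  which allows \<open>k\<close> to vary.
\<close>

definition odd_map_to_punctured :: "(real ^ 'v::finite) set \<Rightarrow> nat \<Rightarrow> (real ^ 'v \<Rightarrow> nat \<Rightarrow> real) \<Rightarrow> bool"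
  where
  "odd_map_to_punctured S k h \<longleftrightarrow>
     continuous_map (top_of_set S) (subtopology (Euclidean_space k) (- {\<lambda>i. 0})) h \<and>
     (\<forall>f\<in>S. h (- f) = (\<lambda>i. - h f i))"

text \<open>The infimum of the empty set in \<^typ>\<open>enat\<close> is \<open>\<infinity>\<close>.\<close>

definition genus :: "(real ^ 'v::finite) set \<Rightarrow> enat" where
  "genus S = (if S = {} then 0
     else Inf {enat k | k. k \<ge> 1 \<and> (\<exists>h. odd_map_to_punctured S k h)})"

definition admissible :: "nat \<Rightarrow> real \<Rightarrow> ('v::finite \<Rightarrow> real) \<Rightarrow> (real ^ 'v) set set" where
  "admissible k p \<mu> =
     {A. compact A \<and> uminus ` A = A \<and> A \<subseteq> p_sphere p \<mu> \<and> genus A \<ge> enat k}"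

text \<open>
  For \<open>1 \<le> k \<le> CARD('v)\<close>, \<open>p > 1\<close> and \<open>\<mu> > 0\<close> the members of \<^term>\<open>admissible k p \<mu>\<close> are nonempty
  and compact, the Rayleigh quotient is continuous on the sphere and bounded on it, and the whole
  sphere is admissible, so both the supremum and the infimum below are the true ones.
\<close>

definition variational_eigenvalue ::
  "real \<Rightarrow> 'v::finite set set \<Rightarrow> ('v set \<Rightarrow> real) \<Rightarrow> ('v \<Rightarrow> real) \<Rightarrow> ('v \<Rightarrow> real) \<Rightarrow>
   nat \<Rightarrow> real" where
  "variational_eigenvalue p E w \<mu> \<kappa> k =
     (INF S\<in>admissible k p \<mu>. SUP f\<in>S. rayleigh p E w \<mu> \<kappa> f)"

end

theory Submission
  imports Defs "HOL-Homology.Invariance_of_Domain"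
begin

text \<open>
  Bipartiteness gives a function \<open>\<sigma>\<close> with values \<open>\<plusminus>1\<close> that changes sign along every edge.  Let \<open>f\<close> be
  an eigenfunction for \<open>\<lambda>\<close> and look at the sign of \<open>\<sigma> f\<close>.  Multiplying the eigenvalue equation at \<open>x\<close>
  by \<open>\<bar>c x\<bar>\<^sup>p f x\<close> and summing over \<open>x\<close> expresses \<open>\<lambda> \<Sum>\<mu>\<bar>c f\<bar>\<^sup>p\<close> as a sum over edges, which the
  convexity of \<open>\<bar>t\<bar>\<^sup>p\<close> compares, edge by edge, with the energy of \<open>c f\<close>.

  If \<open>\<sigma> f\<close> never changes sign, then, by connectedness, \<open>f\<close> has no zero and alternates along every
  edge (\<open>sgn_alternating_eigenfunction_nonzero\<close>).  Every \<open>g\<close> is of the form \<open>c f\<close>, and the comparison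
  gives \<open>\<R> g \<le> \<lambda>\<close> (\<open>energy_le_eigenvalue_of_alternating\<close>).  As the whole sphere is a competitor for
  the largest variational eigenvalue, that eigenvalue is at most \<open>\<lambda>\<close>.

  If \<open>\<sigma> f\<close> takes both signs, let \<open>W\<close> be the plane of all \<open>c f\<close> with \<open>c\<close> constant on \<open>{\<sigma> f > 0}\<close> and on
  its complement.  Where \<open>c\<close> jumps along an edge, the values of \<open>f\<close> at its ends do not have opposite
  signs, and there the comparison goes the other way: \<open>\<R> \<ge> \<lambda>\<close> on \<open>W\<close>
  (\<open>eigenvalue_le_energy_of_twist\<close>).  A symmetric set that misses \<open>W\<close> is mapped by the projection along
  \<open>W\<close> to the nonzero vectors of a space of dimension \<open>n - 2\<close>, so every set of genus at least \<open>n - 1\<close>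
  meets \<open>W\<close> (\<open>subspace_of_sign_twists_meets_admissible\<close>), and the second largest variational
  eigenvalue is at least \<open>\<lambda>\<close>.

  Both bounds require the families in the min-max to be nonempty, that is, the sphere to have genus
  \<open>n\<close>; this is the Borsuk-Ulam theorem (\<open>Borsuk_Ulam_vec\<close>).  It is derived from the theorem that an odd
  self-map of a sphere that preserves the equator has a degree of the same parity as its restriction
  to the equator.  To apply it in every dimension, an odd map into the nonzero vectors is replaced by
  a polynomial one and composed with a generic matrix; then no point of a coordinate subsphere of
  dimension \<open>j\<close> is sent to a vector whose first \<open>j + 1\<close> coordinates vanish
  (\<open>negligible_matrices_vanishing_on_subsphere\<close>), and the degree of the truncated maps stays odd from
  the zero-sphere upwards (\<open>odd_degree_of_filtered_odd_map\<close>).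
\<close>

section \<open>Odd maps of spheres and their degree\<close>

text \<open>
  The topspace of \<^term>\<open>nsphere j\<close> as a plain set: its topology is that of a subspace of the type
  class topology on sequences, so continuity can be handled with \<^const>\<open>continuous_on\<close>.
\<close>

definition unit_seqs :: "nat \<Rightarrow> (nat \<Rightarrow> real) set" where
  "unit_seqs j = {u. (\<Sum>i\<le>j. (u i)\<^sup>2) = 1 \<and> (\<forall>i>j. u i = 0)}"

lemma nsphere_eq_top_of_set: "nsphere j = top_of_set (unit_seqs j)"
  by (simp add: nsphere unit_seqs_def euclidean_product_topology)

lemma unit_seqs_Suc_iff: "u \<in> unit_seqs j \<longleftrightarrow> u \<in> unit_seqs (Suc j) \<and> u (Suc j) = 0"
  by (auto simp: unit_seqs_def elim: less_SucE) (metis Suc_lessI)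

definition truncate_normalize :: "nat \<Rightarrow> (nat \<Rightarrow> real) \<Rightarrow> nat \<Rightarrow> real" where
  "truncate_normalize j y = (\<lambda>i. if i \<le> j then y i / sqrt (\<Sum>k\<le>j. (y k)\<^sup>2) else 0)"

lemma sum_squares_pos_iff: "(\<Sum>k\<le>j. (y k)\<^sup>2) > 0 \<longleftrightarrow> (\<exists>i\<le>j. y i \<noteq> (0::real))" for j :: nat
proof -
  have "(\<Sum>k\<le>j. (y k)\<^sup>2) = 0 \<longleftrightarrow> (\<forall>i\<le>j. y i = 0)"
    by (subst sum_nonneg_eq_0_iff) auto
  moreover have "(\<Sum>k\<le>j. (y k)\<^sup>2) \<ge> 0" by (simp add: sum_nonneg)
  ultimately show ?thesis by (metis less_eq_real_def order_less_irrefl)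
qed

lemma truncate_normalize_in_unit_seqs:
  assumes "\<exists>i\<le>j. y i \<noteq> 0"
  shows "truncate_normalize j y \<in> unit_seqs j"
proof -
  have "(\<Sum>k\<le>j. (y k)\<^sup>2) > 0" using assms by (simp add: sum_squares_pos_iff)
  then show ?thesis
    by (simp add: unit_seqs_def truncate_normalize_def power_divide flip: sum_divide_distrib)
qed

lemma continuous_on_truncate_normalize:
  assumes "\<And>i. i \<le> j \<Longrightarrow> continuous_on S (\<lambda>u. G u i)" "\<And>u. u \<in> S \<Longrightarrow> \<exists>i\<le>j. G u i \<noteq> 0"
  shows "continuous_on S (\<lambda>u. truncate_normalize j (G u))"
proof (rule continuous_on_coordinatewise_then_product)
  fix i
  have pos: "(\<Sum>k\<le>j. (G u k)\<^sup>2) \<noteq> 0" if "u \<in> S" for u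
    using assms(2)[OF that] sum_squares_pos_iff[of "G u" j] by (metis order_less_irrefl)
  show "continuous_on S (\<lambda>u. truncate_normalize j (G u) i)"
    unfolding truncate_normalize_def
    by (cases "i \<le> j") (use assms(1) pos in \<open>auto intro!: continuous_intros\<close>)
qed

lemma truncate_normalize_uminus:
  "truncate_normalize j (\<lambda>i. - y i) = (\<lambda>i. - truncate_normalize j y i)"
  by (auto simp: truncate_normalize_def)

lemma truncate_normalize_cong:
  "(\<And>i. i \<le> j \<Longrightarrow> y i = z i) \<Longrightarrow> truncate_normalize j y = truncate_normalize j z"
  by (simp add: truncate_normalize_def fun_eq_iff)

lemma truncate_normalize_Suc_zero:
  "y (Suc j) = 0 \<Longrightarrow> truncate_normalize (Suc j) y = truncate_normalize j y"
  by (auto simp: truncate_normalize_def le_Suc_eq)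

text \<open>
  Induction on the dimension.  The map may be deformed to preserve the equator: multiply its last
  coordinate by a factor that goes from \<open>1\<close> to \<open>\<bar>u\<^sub>N\<bar>\<close>, where \<open>u\<^sub>N\<close> is the last coordinate of the
  argument.  Off the equator the factor stays positive, and on the equator the other coordinates
  already do not all vanish, so no zero appears on the way.  The degree theorem then passes the
  parity on from the equator.  In dimension zero an odd map is the identity or the reflection.
\<close>

lemma odd_degree_of_filtered_odd_map:
  fixes G :: "(nat \<Rightarrow> real) \<Rightarrow> nat \<Rightarrow> real"
  assumes cont: "\<And>i. continuous_on (unit_seqs N) (\<lambda>u. G u i)"
    and odd: "\<And>u. u \<in> unit_seqs N \<Longrightarrow> G (\<lambda>i. - u i) = (\<lambda>i. - G u i)"
    and nz: "\<And>j u. j \<le> N \<Longrightarrow> u \<in> unit_seqs j \<Longrightarrow> \<exists>i\<le>j. G u i \<noteq> 0"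
  shows "odd (Brouwer_degree2 N (\<lambda>u. truncate_normalize N (G u)))"
  using assms
proof (induction N)
  case 0
  let ?f = "\<lambda>u. truncate_normalize 0 (G u)"
  define e :: "nat \<Rightarrow> real" where "e = (\<lambda>i. if i = 0 then 1 else 0)"
  have S0: "unit_seqs 0 = {e, \<lambda>i. - e i}"
    by (auto simp: unit_seqs_def e_def fun_eq_iff power2_eq_1_iff)
  have eS: "e \<in> unit_seqs 0" by (simp add: S0)
  have f1: "?f (\<lambda>i. - e i) = (\<lambda>i. - ?f e i)"
    using "0.prems"(2)[OF eS] by (simp add: truncate_normalize_uminus)
  have "?f e \<in> unit_seqs 0"
    by (rule truncate_normalize_in_unit_seqs) (use "0.prems"(3)[of 0 e] eS in auto)
  then consider "?f e = e" | "?f e = (\<lambda>i. - e i)" by (auto simp: S0)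
  then show ?case
  proof cases
    case 1
    have "Brouwer_degree2 0 ?f = Brouwer_degree2 0 id"
      by (rule Brouwer_degree2_eq) (use 1 f1 in \<open>auto simp: nsphere_eq_top_of_set S0\<close>)
    then show ?thesis by simp
  next
    case 2
    have "Brouwer_degree2 0 ?f = Brouwer_degree2 0 (\<lambda>x i. if i = 0 then - x i else x i)"
    proof (rule Brouwer_degree2_eq)
      fix x assume "x \<in> topspace (nsphere 0)"
      then consider (pos) "x = e" | "x = (\<lambda>i. - e i)" by (auto simp: nsphere_eq_top_of_set S0)
      then show "?f x = (\<lambda>i. if i = 0 then - x i else x i)"
      proof cases
        case pos
        show ?thesis unfolding pos 2 by (auto simp: e_def)
      next
        assume x: "x = (\<lambda>i. - e i)"
        show ?thesis unfolding x f1 2 by (auto simp: e_def)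
      qed
    qed
    then show ?thesis using Brouwer_degree2_reflection[of 0] by simp
  qed
next
  case (Suc N)
  let ?S = "unit_seqs (Suc N)"
  have sub: "unit_seqs N \<subseteq> ?S" using unit_seqs_Suc_iff by blast
  \<comment> \<open>the deformation: \<open>M 0\<close> is \<open>G\<close>, and \<open>M 1\<close> vanishes in the last coordinate on the equator\<close>
  define M :: "real \<Rightarrow> (nat \<Rightarrow> real) \<Rightarrow> nat \<Rightarrow> real" where
    "M = (\<lambda>t u i. if i = Suc N then ((1 - t) + t * \<bar>u (Suc N)\<bar>) * G u i else G u i)"
  have nzM: "\<exists>i\<le>Suc N. M t u i \<noteq> 0" if tu: "t \<in> {0..1}" "u \<in> ?S" for t u
  proof (cases "u (Suc N) = 0")
    case True
    then have "u \<in> unit_seqs N" using that(2) unit_seqs_Suc_iff by blast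
    then obtain i where "i \<le> N" "G u i \<noteq> 0" using Suc.prems(3)[of N u] by auto
    then show ?thesis by (intro exI[of _ i]) (auto simp: M_def)
  next
    case False
    have "(1 - t) + t * \<bar>u (Suc N)\<bar> > 0"
      using that(1) False by (cases "t = 1") (auto intro: add_pos_nonneg)
    moreover obtain i where "i \<le> Suc N" "G u i \<noteq> 0" using Suc.prems(3)[of "Suc N" u] tu(2) by auto
    ultimately show ?thesis by (intro exI[of _ i]) (auto simp: M_def)
  qed
  have coord: "continuous_on ({0..1} \<times> ?S) (\<lambda>q. snd q k)" for k
    by (rule continuous_on_product_then_coordinatewise) (rule continuous_on_snd continuous_on_id)+
  have contG: "continuous_on ({0..1} \<times> ?S) (\<lambda>q. G (snd q) k)" for k :: nat
    by (rule continuous_on_compose2[OF Suc.prems(1)]) (auto intro: continuous_intros)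
  have contM: "continuous_on ({0..1} \<times> ?S) (\<lambda>q. M (fst q) (snd q) k)" for k :: nat
    unfolding M_def by (cases "k = Suc N") (auto intro!: continuous_intros contG coord)
  let ?H = "\<lambda>q. truncate_normalize (Suc N) (M (fst q) (snd q))"
  have contH: "continuous_on ({0..1} \<times> ?S) ?H"
    by (rule continuous_on_truncate_normalize) (use contM nzM in auto)
  have homot: "homotopic_with (\<lambda>x. True) (nsphere (Suc N)) (nsphere (Suc N))
     (\<lambda>u. truncate_normalize (Suc N) (M 0 u)) (\<lambda>u. truncate_normalize (Suc N) (M 1 u))"
  proof -
    have "prod_topology (top_of_set {0..1::real}) (nsphere (Suc N)) = top_of_set ({0..1} \<times> ?S)"
      by (simp add: nsphere_eq_top_of_set flip: subtopology_Times)
    moreover have "?H ` ({0..1} \<times> ?S) \<subseteq> ?S"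
      using nzM by (auto intro!: truncate_normalize_in_unit_seqs)
    ultimately show ?thesis
      unfolding homotopic_with_def
      using contH by (intro exI[of _ ?H]) (auto simp: nsphere_eq_top_of_set)
  qed
  have M0: "M 0 = G" by (auto simp: M_def fun_eq_iff)
  let ?F = "\<lambda>u. truncate_normalize (Suc N) (M 1 u)"
  have e1: "Brouwer_degree2 (Suc N) (\<lambda>u. truncate_normalize (Suc N) (G u)) = Brouwer_degree2 (Suc N) ?F"
    using Brouwer_degree2_homotopic[OF homot] by (simp add: M0)
  have FN: "?F u = truncate_normalize N (G u)" if "u \<in> unit_seqs N" for u
  proof -
    have "u (Suc N) = 0" using that unit_seqs_Suc_iff by blast
    then have "?F u = truncate_normalize N (M 1 u)"
      by (intro truncate_normalize_Suc_zero) (simp add: M_def)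
    also have "\<dots> = truncate_normalize N (G u)"
      by (rule truncate_normalize_cong) (simp add: M_def)
    finally show ?thesis .
  qed
  have "even (Brouwer_degree2 (Suc N) ?F - Brouwer_degree2 (Suc N - Suc 0) ?F)"
  proof (rule Borsuk_odd_mapping_degree_step)
    show "continuous_map (nsphere (Suc N)) (nsphere (Suc N)) ?F"
      using homotopic_with_imp_continuous_maps[OF homot] by auto
    show "(?F \<circ> (\<lambda>x i. - x i)) u = ((\<lambda>x i. - x i) \<circ> ?F) u" if "u \<in> topspace (nsphere (Suc N))" for u
    proof -
      have "M 1 (\<lambda>i. - u i) = (\<lambda>i. - M 1 u i)"
        using Suc.prems(2)[of u] that by (auto simp: M_def nsphere_eq_top_of_set fun_eq_iff)
      then show ?thesis by (simp add: truncate_normalize_uminus)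
    qed
    show "?F \<in> topspace (nsphere (Suc N - Suc 0)) \<rightarrow> topspace (nsphere (Suc N - Suc 0))"
      using Suc.prems(3)[of N] FN by (auto simp: nsphere_eq_top_of_set intro!: truncate_normalize_in_unit_seqs)
  qed
  moreover have "Brouwer_degree2 N ?F = Brouwer_degree2 N (\<lambda>u. truncate_normalize N (G u))"
    by (rule Brouwer_degree2_eq) (simp add: nsphere_eq_top_of_set FN)
  moreover have "odd (Brouwer_degree2 N (\<lambda>u. truncate_normalize N (G u)))"
    by (rule Suc.IH) (use Suc.prems sub continuous_on_subset in \<open>auto intro: continuous_on_subset\<close>)
  ultimately show ?case using e1 by simp
qed

section \<open>Generic linear maps\<close>

lemma differentiable_vec_lambda:
  fixes f :: "'a::euclidean_space \<Rightarrow> 'n::finite \<Rightarrow> 'b::real_normed_vector"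
  assumes "\<And>i. (\<lambda>x. f x i) differentiable (at a within S)"
  shows "(\<lambda>x. \<chi> i. f x i) differentiable (at a within S)"
proof -
  obtain D where D: "\<And>i. ((\<lambda>x. f x i) has_derivative D i) (at a within S)"
    using assms unfolding differentiable_def by metis
  have "linear (\<lambda>h. \<chi> i. D i h)"
    using linear_add[OF has_derivative_linear[OF D]] linear_cmul[OF has_derivative_linear[OF D]]
    by (intro linearI) (auto simp: vec_eq_iff)
  then have "bounded_linear (\<lambda>h. \<chi> i. D i h)" by (simp add: linear_conv_bounded_linear)
  then have "((\<lambda>x. \<chi> i. f x i) has_derivative (\<lambda>h. \<chi> i. D i h)) (at a within S)"
    using D by (auto simp: has_derivative_def intro!: vec_tendstoI)
  then show ?thesis unfolding differentiable_def by blast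
qed

lemma differentiable_vec_nth:
  fixes f :: "'a::real_normed_vector \<Rightarrow> ('b::real_normed_vector) ^ 'n::finite"
  assumes "f differentiable (at a within S)"
  shows "(\<lambda>x. f x $ i) differentiable (at a within S)"
  using assms unfolding differentiable_def
  by (blast intro: bounded_linear.has_derivative[OF bounded_linear_vec_nth])

text \<open>
  Every ray from the origin meets this set at most once.
\<close>

lemma negligible_column_cylinder:
  fixes I :: "'n::finite set"
  shows "negligible {M :: real^'n^'n. (\<Sum>v\<in>I. (M $ v $ c)\<^sup>2) = 1}"
proof (rule starlike_negligible[where a = 0])
  show "closed {M :: real^'n^'n. (\<Sum>v\<in>I. (M $ v $ c)\<^sup>2) = 1}"
    by (intro closed_Collect_eq continuous_intros)
  fix r and M :: "real^'n^'n"
  assume r: "0 \<le> r" and 1: "0 + r *\<^sub>R M \<in> {M. (\<Sum>v\<in>I. (M $ v $ c)\<^sup>2) = 1}"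
    "0 + M \<in> {M. (\<Sum>v\<in>I. (M $ v $ c)\<^sup>2) = 1}"
  then have "r\<^sup>2 * (\<Sum>v\<in>I. (M $ v $ c)\<^sup>2) = 1" by (simp add: power_mult_distrib flip: sum_distrib_left)
  then show "r = 1" using 1 r by (simp add: power2_eq_1_iff)
qed

text \<open>
  Dimension count: each row of \<open>L\<close> with index in \<open>I\<close> has to satisfy one linear equation, while \<open>x\<close>
  ranges over a sphere of dimension \<open>\<bar>I\<bar> - 1\<close>, one less than the number of equations.  To stay within
  the space of matrices, choose a column \<open>c\<close> with \<open>(P x)\<^sub>c \<noteq> 0\<close>.  The equations determine the entries
  of \<open>L\<close> in the rows \<open>I\<close> of that column, so these entries are free to store the coordinates of \<open>x\<close>
  instead.  The bad matrices are thus the images, under the differentiable maps \<open>F c\<close> that solve the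
  equations, of matrices whose column \<open>c\<close> restricted to \<open>I\<close> is a unit vector.
\<close>

lemma negligible_matrices_vanishing_on_subsphere:
  fixes P :: "real^'n \<Rightarrow> real^'n" and I :: "'n::finite set"
  assumes diff: "\<And>x. P differentiable (at x)"
    and nz: "\<And>x. norm x = 1 \<Longrightarrow> P x \<noteq> 0"
  shows "negligible {L :: real^'n^'n. \<exists>x. norm x = 1 \<and> (\<forall>v. v \<notin> I \<longrightarrow> x $ v = 0) \<and>
                                    (\<forall>v\<in>I. (L *v P x) $ v = 0)}" (is "negligible ?B")
proof -
  define X where "X c M = (\<chi> v. if v \<in> I then M $ v $ c else 0)" for c and M :: "real^'n^'n"
  define F where "F c M = (\<chi> v u. if v \<in> I \<and> u = c
        then - (\<Sum>d\<in>UNIV - {c}. M $ v $ d * P (X c M) $ d) / P (X c M) $ c else M $ v $ u)"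
      for c and M :: "real^'n^'n"
  define S where "S c = {M :: real^'n^'n. (\<Sum>v\<in>I. (M $ v $ c)\<^sup>2) = 1 \<and> P (X c M) $ c \<noteq> 0}" for c
  have "negligible (F c ` S c)" for c
  proof (rule negligible_differentiable_image_negligible)
    show "negligible (S c)"
      by (rule negligible_subset[OF negligible_column_cylinder[where I = I and c = c]]) (auto simp: S_def)
    have dM: "(\<lambda>M. M $ v $ u) differentiable (at M within S c)" for v u and M :: "real^'n^'n"
      by (intro differentiable_vec_nth differentiable_ident)
    have dX: "X c differentiable (at M within S c)" for M
      unfolding X_def 
    proof (rule differentiable_vec_lambda)
      show "(\<lambda>M. if v \<in> I then M $ v $ c else 0) differentiable (at M within S c)" for v
        by (cases "v \<in> I") (auto intro: dM)
    qed
    have dPX: "(\<lambda>M. P (X c M) $ d) differentiable (at M within S c)" for M d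
      by (rule differentiable_vec_nth, rule differentiable_compose[OF diff dX])
    show "F c differentiable_on S c"
      unfolding differentiable_on_def
    proof
      fix M assume "M \<in> S c"
      then have PM: "P (X c M) $ c \<noteq> 0" by (simp add: S_def)
      show "F c differentiable at M within S c"
        unfolding F_def
      proof (intro differentiable_vec_lambda)
        fix v u
        show "(\<lambda>M. if v \<in> I \<and> u = c
          then - (\<Sum>d\<in>UNIV - {c}. M $ v $ d * P (X c M) $ d) / P (X c M) $ c else M $ v $ u)
          differentiable at M within S c"
          using PM by (cases "v \<in> I \<and> u = c")
            (auto intro!: differentiable_divide differentiable_minus differentiable_sum
              differentiable_mult dM dPX)
      qed
    qed
  qed auto
  then have "negligible (\<Union>c. F c ` S c)" by (intro negligible_Union) auto
  moreover have "?B \<subseteq> (\<Union>c. F c ` S c)"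
  proof
    fix L assume "L \<in> ?B"
    then obtain x where x: "norm x = 1" "\<And>v. v \<notin> I \<Longrightarrow> x $ v = 0" "\<And>v. v \<in> I \<Longrightarrow> (L *v P x) $ v = 0"
      by blast
    obtain c where c: "P x $ c \<noteq> 0" using nz[OF x(1)] by (metis vec_eq_iff zero_index)
    \<comment> \<open>store \<open>x\<close> in the entries that the equations determine\<close>
    define M :: "real^'n^'n" where "M = (\<chi> v u. if v \<in> I \<and> u = c then x $ v else L $ v $ u)"
    have XM: "X c M = x" using x(2) by (auto simp: X_def M_def vec_eq_iff)
    have "(\<Sum>v\<in>I. (M $ v $ c)\<^sup>2) = (\<Sum>v\<in>UNIV. (x $ v)\<^sup>2)"
      using x(2) by (intro sum.mono_neutral_cong_left) (auto simp: M_def)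
    also have "\<dots> = 1" using x(1) by (simp add: norm_vec_def L2_set_def)
    finally have "M \<in> S c" using c XM by (simp add: S_def)
    moreover have "F c M = L"
    proof -
      have "L $ v $ c = - (\<Sum>d\<in>UNIV - {c}. M $ v $ d * P x $ d) / P x $ c" if "v \<in> I" for v
      proof -
        have "0 = (\<Sum>d\<in>UNIV. L $ v $ d * P x $ d)"
          using x(3)[OF that] by (simp add: matrix_vector_mult_def)
        also have "\<dots> = L $ v $ c * P x $ c + (\<Sum>d\<in>UNIV - {c}. L $ v $ d * P x $ d)"
          by (simp add: sum.remove)
        also have "(\<Sum>d\<in>UNIV - {c}. L $ v $ d * P x $ d) = (\<Sum>d\<in>UNIV - {c}. M $ v $ d * P x $ d)"
          by (rule sum.cong) (auto simp: M_def)
        finally show ?thesis using c by (simp add: field_simps)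
      qed
      then show ?thesis by (auto simp: F_def XM vec_eq_iff) (auto simp: M_def)
    qed
    ultimately show "L \<in> (\<Union>c. F c ` S c)" by blast
  qed
  ultimately show ?thesis by (rule negligible_subset)
qed

section \<open>The Borsuk-Ulam theorem\<close>

text \<open>
  The polynomial comes from the Stone-Weierstrass theorem with an error below the minimum of
  \<open>\<parallel>g\<parallel>\<close> on the sphere; taking its odd part and deleting the coordinate \<open>v0\<close> do not increase the error.
\<close>

lemma odd_polynomial_approximation:
  fixes g :: "real^'n \<Rightarrow> real^'n"
  assumes cont: "continuous_on (sphere 0 1) g"
    and odd: "\<And>x. norm x = 1 \<Longrightarrow> g (- x) = - g x"
    and coord: "\<And>x. norm x = 1 \<Longrightarrow> g x $ v0 = 0"
    and nz: "\<And>x. norm x = 1 \<Longrightarrow> g x \<noteq> 0"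
  shows "\<exists>P :: real^'n \<Rightarrow> real^'n. (\<forall>x. P differentiable (at x)) \<and> (\<forall>x. P (- x) = - P x) \<and>
    (\<forall>x. P x $ v0 = 0) \<and> (\<forall>x. norm x = 1 \<longrightarrow> P x \<noteq> 0)"
proof -
  let ?S = "sphere 0 1 :: (real^'n) set"
  obtain x0 where x0: "x0 \<in> ?S" "\<And>x. x \<in> ?S \<Longrightarrow> norm (g x0) \<le> norm (g x)"
  proof -
    have "?S \<noteq> {}" by simp
    then have "\<exists>x\<in>?S. \<forall>y\<in>?S. norm (g x) \<le> norm (g y)"
      by (intro continuous_attains_inf compact_sphere continuous_on_norm cont)
    then show ?thesis using that by blast
  qed
  have pos: "norm (g x0) > 0" using x0 nz by auto
  then obtain q where q: "polynomial_function q" "\<And>x. x \<in> ?S \<Longrightarrow> norm (g x - q x) < norm (g x0)"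
    using Stone_Weierstrass_polynomial_function[OF compact_sphere cont pos] by blast
  define P where "P x = (\<chi> v. if v = v0 then 0 else (q x $ v - q (- x) $ v) / 2)" for x
  show ?thesis
  proof (intro exI[of _ P] conjI allI impI)
    fix x
    have dq: "q differentiable (at y)" for y
      using differentiable_at_polynomial_function[OF q(1), of y UNIV] by simp
    have dq': "(\<lambda>x. q (- x)) differentiable (at x)"
      by (rule differentiable_compose[OF dq differentiable_minus[OF differentiable_ident]])
    have "(\<lambda>x. P x) differentiable (at x)"
      unfolding P_def
    proof (rule differentiable_vec_lambda)
      fix i
      show "(\<lambda>x. if i = v0 then 0 else (q x $ i - q (- x) $ i) / 2) differentiable at x"
        using differentiable_vec_nth[OF dq] differentiable_vec_nth[OF dq']
        by (cases "i = v0") (auto intro!: differentiable_divide differentiable_diff)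
    qed
    then show "P differentiable (at x)" .
    show "P (- x) = - P x" "P x $ v0 = 0" by (simp_all add: P_def vec_eq_iff field_simps)
    show "P x \<noteq> 0" if x: "norm x = 1"
    proof
      assume P0: "P x = 0"
      define d where "d y = g y - q y" for y
      have eq: "g x $ v = (d x $ v - d (- x) $ v) / 2" if "v \<noteq> v0" for v
      proof -
        have "q x $ v - q (- x) $ v = 0" using arg_cong[OF P0, of "\<lambda>y. y $ v"] that by (simp add: P_def)
        then show ?thesis using odd[OF x] by (simp add: d_def)
      qed
      have "norm (g x) \<le> norm ((1/2) *\<^sub>R (d x - d (- x)))"
       
      proof (rule norm_le_componentwise_cart)
        fix v
        show "norm (g x $ v) \<le> norm (((1/2) *\<^sub>R (d x - d (- x))) $ v)"
          using eq[of v] coord[OF x] by (cases "v = v0") auto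
      qed
      also have "\<dots> \<le> (norm (d x) + norm (d (- x))) / 2"
        using norm_triangle_ineq4[of "d x" "d (- x)"] by simp
      also have "\<dots> < norm (g x0)"
        using q(2)[of x] q(2)[of "- x"] x by (simp add: d_def)
      finally show False using x0(2)[of x] x by simp
    qed
  qed
qed



text \<open>
  Otherwise a polynomial approximation \<open>P\<close> of \<open>g\<close>, composed with a generic matrix \<open>L\<close>, normalizes to an
  odd self-map of the sphere of odd degree.  But \<open>P\<close> takes values in a hyperplane, so \<open>L P\<close> does too,
  and a normal vector of that hyperplane is not attained: the degree is zero.
\<close>

theorem Borsuk_Ulam_vec:
  fixes g :: "real^'n \<Rightarrow> real^'n"
  assumes cont: "continuous_on (sphere 0 1) g"
    and odd: "\<And>x. norm x = 1 \<Longrightarrow> g (- x) = - g x"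
    and coord: "\<And>x. norm x = 1 \<Longrightarrow> g x $ v0 = 0"
  shows "\<exists>x. norm x = 1 \<and> g x = 0"
proof (rule ccontr)
  assume "\<not> ?thesis"
  then have nz: "\<And>x. norm x = 1 \<Longrightarrow> g x \<noteq> 0" by auto
  obtain P :: "real^'n \<Rightarrow> real^'n" where P: "\<And>x. P differentiable (at x)" "\<And>x. P (- x) = - P x"
    "\<And>x. P x $ v0 = 0" "\<And>x. norm x = 1 \<Longrightarrow> P x \<noteq> 0"
    using odd_polynomial_approximation[of g v0, OF cont odd coord nz] by blast
  define B where "B I = {L :: real^'n^'n. \<exists>x. norm x = 1 \<and> (\<forall>v. v \<notin> I \<longrightarrow> x $ v = 0) \<and>
                                    (\<forall>v\<in>I. (L *v P x) $ v = 0)}" for I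
  have "negligible (\<Union>I. B I)"
    using negligible_matrices_vanishing_on_subsphere[of P, OF P(1,4)]
    by (intro negligible_Union) (auto simp: B_def)
  then have "(\<Union>I. B I) \<noteq> UNIV" using non_negligible_UNIV by (intro notI) simp
  then obtain L where L: "\<And>I. L \<notin> B I" by blast
  \<comment> \<open>The coordinates are numbered \<open>0, \<dots>, N\<close> by \<open>b\<close>, because \<^const>\<open>nsphere\<close> lives in sequences.\<close>
  define N where "N = CARD('n) - 1"
  have cardN: "CARD('n) = Suc N" by (simp add: N_def)
  obtain b where "bij_betw b (UNIV :: 'n set) {0..<CARD('n)}"
    using ex_bij_betw_finite_nat[OF finite_class.finite_UNIV] by blast
  then have b: "bij_betw b (UNIV :: 'n set) {..N}"
    by (simp add: cardN atLeast0LessThan lessThan_Suc_atMost)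
  define c where "c = inv_into UNIV b"
  have cb: "c (b v) = v" for v using b by (simp add: c_def bij_betw_inv_into_left)
  have bc: "b (c i) = i" if "i \<le> N" for i
    using b that by (simp add: c_def bij_betw_inv_into_right)
  have bN: "b v \<le> N" for v using b by (auto simp: bij_betw_def)
  have reindex: "(\<Sum>v\<in>UNIV. h (b v)) = (\<Sum>i\<le>N. h i)" for h :: "nat \<Rightarrow> real"
    by (rule sum.reindex_bij_betw[OF b])
  define vec_of where "vec_of u = ((\<chi> v. u (b v)) :: real^'n)" for u
  define G where "G u i = (L *v P (vec_of u)) $ c i" for u i
  have contP: "continuous_on UNIV P"
    by (simp add: P(1) continuous_at_imp_continuous_on differentiable_imp_continuous_within)
  have contv: "continuous_on S vec_of" for S
    unfolding vec_of_def
    by (intro continuous_on_vec_lambda continuous_on_product_coordinates[THEN continuous_on_subset]) auto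
  have contG: "continuous_on (unit_seqs N) (\<lambda>u. G u i)" for i
  proof -
    have "continuous_on (unit_seqs N) (\<lambda>u. P (vec_of u))"
      by (rule continuous_on_compose2[OF contP contv]) auto
    then have "continuous_on (unit_seqs N) (\<lambda>u. L *v P (vec_of u))"
      by (rule bounded_linear.continuous_on[OF matrix_vector_mul_bounded_linear])
    then show ?thesis unfolding G_def by (rule continuous_on_component)
  qed
  have oddG: "G (\<lambda>i. - u i) = (\<lambda>i. - G u i)" for u
  proof -
    have "vec_of (\<lambda>i. - u i) = - vec_of u" by (auto simp: vec_of_def vec_eq_iff)
    then show ?thesis by (simp add: G_def P(2) fun_eq_iff)
      (simp add: matrix_vector_mult_def sum_negf)
  qed
  have norm1: "norm (vec_of u) = 1" if "u \<in> unit_seqs j" "j \<le> N" for u j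
  proof -
    have "(\<Sum>v\<in>UNIV. (u (b v))\<^sup>2) = (\<Sum>i\<le>N. (u i)\<^sup>2)" by (rule reindex)
    also have "\<dots> = (\<Sum>i\<le>j. (u i)\<^sup>2)"
      using that by (intro sum.mono_neutral_right) (auto simp: unit_seqs_def)
    finally show ?thesis using that by (simp add: norm_vec_def L2_set_def vec_of_def unit_seqs_def)
  qed
  have nzG: "\<exists>i\<le>j. G u i \<noteq> 0" if ju: "j \<le> N" "u \<in> unit_seqs j" for j u
  proof -
    have "\<forall>v. v \<notin> {v. b v \<le> j} \<longrightarrow> vec_of u $ v = 0"
      using that by (auto simp: vec_of_def unit_seqs_def)
    then obtain v where "b v \<le> j" "(L *v P (vec_of u)) $ v \<noteq> 0"
      using L[of "{v. b v \<le> j}"] norm1[OF ju(2,1)] by (auto simp: B_def)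
    then show ?thesis by (auto simp: G_def cb intro!: exI[of _ "b v"])
  qed
  let ?f = "\<lambda>u. truncate_normalize N (G u)"
  have "odd (Brouwer_degree2 N ?f)"
    by (rule odd_degree_of_filtered_odd_map) (use contG oddG nzG in auto)
  moreover have "Brouwer_degree2 N ?f = 0"
  proof (rule Brouwer_degree2_nonsurjective)
    have into: "?f u \<in> unit_seqs N" if "u \<in> unit_seqs N" for u
      by (rule truncate_normalize_in_unit_seqs) (use nzG that in auto)
    show "continuous_map (nsphere N) (nsphere N) ?f"
      using continuous_on_truncate_normalize[of N "unit_seqs N" G] contG nzG into
      by (auto simp: nsphere_eq_top_of_set)
    \<comment> \<open>A vector \<open>a\<close> orthogonal to the values of \<open>L P\<close>; normalized, it is the missing point.\<close>
    let ?T = "(*v) L ` {y. y $ v0 = 0}"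
    have "dim ?T \<le> dim {y :: real^'n. y $ v0 = 0}" by (rule dim_image_le) auto
    also have "\<dots> < DIM(real^'n)"
    proof -
      have "{y :: real^'n. y $ v0 = 0} = {y. axis v0 1 \<bullet> y = 0}" by (simp add: inner_axis')
      then show ?thesis using dim_hyperplane[of "axis v0 1 :: real^'n"] by (simp add: axis_eq_0_iff)
    qed
    finally obtain a where a: "a \<noteq> 0" "\<And>y. y \<in> span ?T \<Longrightarrow> orthogonal a y"
      using orthogonal_to_subspace_exists by blast
    define s where "s i = (if i \<le> N then a $ c i else 0)" for i
    have s_nz: "\<exists>i\<le>N. s i \<noteq> 0"
    proof -
      obtain v where "a $ v \<noteq> 0" using a(1) by (metis vec_eq_iff zero_index)
      then show ?thesis using bN by (intro exI[of _ "b v"]) (auto simp: s_def cb)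
    qed
    have "truncate_normalize N s \<noteq> ?f u" if u: "u \<in> unit_seqs N" for u
    proof
      assume eq: "truncate_normalize N s = ?f u"
      let ?y = "L *v P (vec_of u)"
      have "a \<bullet> ?y = 0" using a(2)[of ?y] P(3) by (auto simp: orthogonal_def intro: span_base)
      then have "(\<Sum>i\<le>N. s i * G u i) = 0"
        using reindex[of "\<lambda>i. s i * G u i"] bN by (simp add: inner_vec_def s_def G_def cb)
      moreover have "(\<Sum>i\<le>N. s i * G u i) > 0"
      proof -
        define \<rho> \<sigma> where "\<rho> = sqrt (\<Sum>k\<le>N. (s k)\<^sup>2)" and "\<sigma> = sqrt (\<Sum>k\<le>N. (G u k)\<^sup>2)"
        have pos: "\<rho> > 0" "\<sigma> > 0"
          using s_nz nzG[of N u] u sum_squares_pos_iff by (auto simp: \<rho>_def \<sigma>_def)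
        have "G u i = (\<sigma> / \<rho>) * s i" if "i \<le> N" for i
        proof -
          have "s i / \<rho> = G u i / \<sigma>"
            using fun_cong[OF eq, of i] that by (simp add: truncate_normalize_def \<rho>_def \<sigma>_def)
          then show ?thesis using pos by (simp add: field_simps)
        qed
        then have "(\<Sum>i\<le>N. s i * G u i) = (\<sigma> / \<rho>) * (\<Sum>i\<le>N. (s i)\<^sup>2)"
          by (simp add: sum_distrib_left power2_eq_square mult_ac)
        then show ?thesis using pos s_nz sum_squares_pos_iff[of s N] by simp
      qed
      ultimately show False by simp
    qed
    then show "?f ` topspace (nsphere N) \<noteq> topspace (nsphere N)"
      using truncate_normalize_in_unit_seqs[OF s_nz] by (auto simp: nsphere_eq_top_of_set)
  qed
  ultimately show False by simp
qed

section \<open>The genus of the weighted sphere\<close>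

text \<open>
  The contrapositive of the definition of the genus.  That definition only admits dimensions \<open>k \<ge> 1\<close>; for
  \<open>k = 0\<close> the map \<open>h\<close> is zero, and a set of positive genus is nonempty.
\<close>

lemma zero_of_odd_map_below_genus:
  fixes A :: "(real ^ 'v::finite) set" and h :: "real ^ 'v \<Rightarrow> nat \<Rightarrow> real"
  assumes genus: "genus A \<ge> enat (Suc k)"
    and cont: "\<And>i. continuous_on A (\<lambda>f. h f i)"
    and odd: "\<And>f. f \<in> A \<Longrightarrow> h (- f) = (\<lambda>i. - h f i)"
    and range: "\<And>f i. f \<in> A \<Longrightarrow> i \<ge> k \<Longrightarrow> h f i = 0"
  shows "\<exists>f\<in>A. h f = (\<lambda>i. 0)"
proof (rule ccontr)
  assume nz: "\<not> ?thesis"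
  have ne: "A \<noteq> {}" using genus by (auto simp: genus_def zero_enat_def)
  have "k \<ge> 1"
  proof (rule ccontr)
    assume "\<not> k \<ge> 1"
    then have "\<forall>f\<in>A. h f = (\<lambda>i. 0)" using range by (auto simp: fun_eq_iff)
    with nz ne show False by blast
  qed
  moreover have "odd_map_to_punctured A k h"
    using nz range odd continuous_on_coordinatewise_then_product[of A h, OF cont]
    by (auto simp: odd_map_to_punctured_def Euclidean_space_def subtopology_subtopology
        euclidean_product_topology)
  ultimately have "genus A \<le> enat k"
    using ne unfolding genus_def by (auto intro!: Inf_lower)
  with genus have "enat (Suc k) \<le> enat k" by (rule order_trans)
  then show False by simp
qed

lemma continuous_on_abs_powr:
  fixes p :: real
  assumes "p > 0"
  shows "continuous_on S (\<lambda>f :: real^'v. \<bar>f $ x\<bar> powr p)"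
  using assms by (intro continuous_on_powr' continuous_intros) auto

definition weighted_mass :: "real \<Rightarrow> ('v::finite \<Rightarrow> real) \<Rightarrow> real^'v \<Rightarrow> real" where
  "weighted_mass p \<mu> f = (\<Sum>x\<in>UNIV. \<mu> x * \<bar>f $ x\<bar> powr p)"

lemma p_sphere_iff: "f \<in> p_sphere p \<mu> \<longleftrightarrow> weighted_mass p \<mu> f = 1"
  by (simp add: p_sphere_def weighted_mass_def)

lemma continuous_on_weighted_mass:
  "p > 0 \<Longrightarrow> continuous_on S (weighted_mass p \<mu>)"
  unfolding weighted_mass_def by (intro continuous_intros continuous_on_abs_powr)

lemma weighted_mass_uminus [simp]: "weighted_mass p \<mu> (- f) = weighted_mass p \<mu> f"
  by (simp add: weighted_mass_def)

lemma weighted_mass_scaleR: "weighted_mass p \<mu> (c *\<^sub>R f) = \<bar>c\<bar> powr p * weighted_mass p \<mu> f"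
  by (simp add: weighted_mass_def abs_mult powr_mult sum_distrib_left mult_ac)

context
  fixes p :: real and \<mu> :: "'v::finite \<Rightarrow> real"
  assumes p: "p > 0" and \<mu>: "\<And>x. \<mu> x > 0"
begin

lemma term_le_weighted_mass: "\<mu> x * \<bar>f $ x\<bar> powr p \<le> weighted_mass p \<mu> f"
  unfolding weighted_mass_def
  by (rule member_le_sum) (auto simp: \<mu> less_imp_le)

lemma weighted_mass_pos: "f \<noteq> 0 \<Longrightarrow> weighted_mass p \<mu> f > 0"
proof -
  assume "f \<noteq> 0"
  then obtain x where "f $ x \<noteq> 0" by (metis vec_eq_iff zero_index)
  then have "0 < \<mu> x * \<bar>f $ x\<bar> powr p" by (simp add: \<mu>)
  with term_le_weighted_mass[of x f] show ?thesis by linarith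
qed

lemma compact_p_sphere: "compact (p_sphere p \<mu>)"
proof -
  have "closed (p_sphere p \<mu>)"
  proof -
    have "p_sphere p \<mu> = {f. weighted_mass p \<mu> f = 1}" by (auto simp: p_sphere_iff)
    then show ?thesis
      by (simp add: closed_Collect_eq continuous_on_weighted_mass[OF p] del: Collect_cong)
  qed
  moreover have "bounded (p_sphere p \<mu>)"
  proof (rule boundedI)
    fix f assume f: "f \<in> p_sphere p \<mu>"
    have "\<bar>f $ x\<bar> \<le> (1 / \<mu> x) powr (1 / p)" for x
    proof -
      have "\<bar>f $ x\<bar> powr p \<le> 1 / \<mu> x"
        using term_le_weighted_mass[of x f] f \<mu>[of x] by (simp add: p_sphere_iff field_simps)
      then have "(\<bar>f $ x\<bar> powr p) powr (1 / p) \<le> (1 / \<mu> x) powr (1 / p)"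
        using p by (intro powr_mono2) auto
      then show ?thesis using p by (simp add: powr_powr)
    qed
    then have "(\<Sum>x\<in>UNIV. \<bar>f $ x\<bar>) \<le> (\<Sum>x\<in>UNIV. (1 / \<mu> x) powr (1 / p))" by (intro sum_mono)
    then show "norm f \<le> (\<Sum>x\<in>UNIV. (1 / \<mu> x) powr (1 / p))"
      using norm_le_l1_cart[of f] by linarith
  qed
  ultimately show ?thesis by (simp add: compact_eq_bounded_closed)
qed

text \<open>
  Radial projection is an odd map from the Euclidean sphere, so an odd map to the nonzero vectors of
  a space of smaller dimension would contradict the Borsuk-Ulam theorem.
\<close>

lemma genus_p_sphere: "genus (p_sphere p \<mu>) \<ge> enat CARD('v)"
proof -
  define r where "r f = (1 / weighted_mass p \<mu> f powr (1 / p)) *\<^sub>R f" for f :: "real^'v"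
  have r_in: "r f \<in> p_sphere p \<mu>" if "f \<noteq> 0" for f
    using weighted_mass_pos[OF that] p
    by (simp add: p_sphere_iff r_def weighted_mass_scaleR powr_divide powr_powr)
  have ne: "p_sphere p \<mu> \<noteq> {}"
    using r_in[of "axis undefined 1"] by (auto simp: axis_eq_0_iff)
  have "enat CARD('v) \<le> enat k" if "odd_map_to_punctured (p_sphere p \<mu>) k h" for k h
  proof (rule ccontr)
    assume "\<not> ?thesis"
    then have k: "k < CARD('v)" by simp
    obtain b where b: "bij_betw b (UNIV :: 'v set) {0..<CARD('v)}"
      using ex_bij_betw_finite_nat[OF finite_class.finite_UNIV] by blast
    then have "b ` UNIV = {0..<CARD('v)}" by (simp add: bij_betw_def)
    then have surj: "\<exists>v. b v = i" if "i < CARD('v)" for i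
      using that by (metis atLeastLessThan_iff imageE zero_le)
    have h: "continuous_on (p_sphere p \<mu>) h"
      and h_nz: "\<And>f. f \<in> p_sphere p \<mu> \<Longrightarrow> h f \<noteq> (\<lambda>i. 0)"
      and h_range: "\<And>f i. f \<in> p_sphere p \<mu> \<Longrightarrow> i \<ge> k \<Longrightarrow> h f i = 0"
      and h_odd: "\<And>f. f \<in> p_sphere p \<mu> \<Longrightarrow> h (- f) = (\<lambda>i. - h f i)"
      using that by (auto simp: odd_map_to_punctured_def Euclidean_space_def subtopology_subtopology
        euclidean_product_topology)
    define g where "g f = (\<chi> v. h (r f) (b v))" for f
    have r_uminus: "r (- f) = - r f" for f by (simp add: r_def)
    have nz: "f \<noteq> 0" if "norm f = 1" for f :: "real^'v" using that by auto
    have "continuous_on (sphere 0 1) r"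
      unfolding r_def using weighted_mass_pos p
      by (intro continuous_intros continuous_on_powr' continuous_on_weighted_mass)
        (force dest: nz simp: less_imp_le)+
    then have hr: "continuous_on (sphere 0 1) (\<lambda>f. h (r f))"
      by (rule continuous_on_compose2[OF h]) (auto intro!: r_in)
    obtain v0 where v0: "b v0 = k" using surj[OF k] by blast
    have "\<exists>f. norm f = 1 \<and> g f = 0"
    proof (rule Borsuk_Ulam_vec)
      show "continuous_on (sphere 0 1) g"
        unfolding g_def
        by (intro continuous_on_vec_lambda continuous_on_product_then_coordinatewise[OF hr])
      show "g (- f) = - g f" if "norm f = 1" for f
        using h_odd[OF r_in[OF nz[OF that]]] by (simp add: g_def r_uminus vec_eq_iff)
      show "g f $ v0 = 0" if "norm f = 1" for f
        using h_range[OF r_in[OF nz[OF that]]] by (simp add: g_def v0)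
    qed
    then obtain f where f: "norm f = 1" "g f = 0" by blast
    have rf: "r f \<in> p_sphere p \<mu>" using r_in nz f(1) by blast
    have "h (r f) i = 0" for i
    proof (cases "i < CARD('v)")
      case True
      then obtain v where "b v = i" using surj by blast
      then show ?thesis using f(2) by (auto simp: g_def vec_eq_iff)
    next
      case False
      then show ?thesis using h_range[OF rf] k by auto
    qed
    then show False using h_nz[OF rf] by auto
  qed
  then show ?thesis using ne unfolding genus_def by (auto intro!: Inf_greatest)
qed

lemma p_sphere_admissible: "k \<le> CARD('v) \<Longrightarrow> p_sphere p \<mu> \<in> admissible k p \<mu>"
proof -
  assume "k \<le> CARD('v)"
  then have "enat k \<le> genus (p_sphere p \<mu>)" using genus_p_sphere by (metis enat_ord_simps(1) order_trans)
  moreover have "uminus ` p_sphere p \<mu> = p_sphere p \<mu>"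
    by (auto simp: p_sphere_iff image_iff intro!: bexI[of _ "- _"])
  ultimately show ?thesis using compact_p_sphere by (simp add: admissible_def)
qed

end

section \<open>Convexity inequalities on an edge\<close>

text \<open>
  Away from \<open>0\<close> this is convexity of \<open>x powr p\<close> and the triangle inequality; at \<open>0\<close> it amounts to
  \<open>a powr p \<le> a\<close> for weights \<open>a\<close>.
\<close>

lemma abs_powr_convex:
  fixes p a u b :: real
  assumes "p \<ge> 1" "0 \<le> a" "a \<le> 1"
  shows "\<bar>(1 - a) * u + a * b\<bar> powr p \<le> (1 - a) * \<bar>u\<bar> powr p + a * \<bar>b\<bar> powr p"
proof -
  have weight: "x powr p \<le> x" if "0 \<le> x" "x \<le> 1" for x :: real
    using powr_mono'[of 1 p x] that assms(1) by (cases "x = 0") auto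
  have "\<bar>(1 - a) * u + a * b\<bar> \<le> (1 - a) * \<bar>u\<bar> + a * \<bar>b\<bar>"
    using assms abs_triangle_ineq[of "(1 - a) * u" "a * b"] by (simp add: abs_mult)
  then have "\<bar>(1 - a) * u + a * b\<bar> powr p \<le> ((1 - a) * \<bar>u\<bar> + a * \<bar>b\<bar>) powr p"
    using assms by (intro powr_mono2) auto
  also have "\<dots> \<le> (1 - a) * \<bar>u\<bar> powr p + a * \<bar>b\<bar> powr p"
  proof (cases "u = 0 \<or> b = 0")
    case True
    then show ?thesis
      using assms weight[of a] weight[of "1 - a"]
      by (auto simp: powr_mult intro!: mult_right_mono)
  next
    case False
    then show ?thesis
      using convex_onD[OF powr_convex[OF assms(1)], of a "\<bar>u\<bar>" "\<bar>b\<bar>"] assms by simp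
  qed
  finally show ?thesis .
qed

lemma Phi_uminus: "Phi p (- t) = - Phi p t"
  by (simp add: Phi_def)

lemma Phi_pos_eq: "t > 0 \<Longrightarrow> Phi p t = t powr (p - 1)"
  using powr_mult_base[of t "p - 2"] by (simp add: Phi_def mult.commute)

lemma mult_Phi: "t * Phi p t = \<bar>t\<bar> powr p"
proof (cases "t = 0")
  case False
  have "t * Phi p t = \<bar>t\<bar> powr (p - 2) * \<bar>t\<bar> powr 2"
    using False by (simp add: Phi_def power2_eq_square)
  also have "\<dots> = \<bar>t\<bar> powr p" by (subst powr_add[symmetric]) simp
  finally show ?thesis .
qed (simp add: Phi_def)

text \<open>
  What an edge with values \<open>s, t\<close> of \<open>f\<close> contributes to \<open>\<Sum>x. \<bar>c x\<bar>\<^sup>p f x \<Delta>\<^sub>p f x\<close>, up to its weight, when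
  the values of \<open>c\<close> at its ends are \<open>c, d\<close>.
\<close>

definition twisted_edge_form :: "real \<Rightarrow> real \<Rightarrow> real \<Rightarrow> real \<Rightarrow> real \<Rightarrow> real" where
  "twisted_edge_form p c d s t = \<bar>c\<bar> powr p * s * Phi p (s - t) + \<bar>d\<bar> powr p * t * Phi p (t - s)"

lemma twisted_edge_form_commute: "twisted_edge_form p c d s t = twisted_edge_form p d c t s"
  by (simp add: twisted_edge_form_def)

lemma twisted_edge_form_uminus: "twisted_edge_form p c d (- s) (- t) = twisted_edge_form p c d s t"
  using Phi_uminus[of p "s - t"] Phi_uminus[of p "t - s"] by (simp add: twisted_edge_form_def)

lemma twisted_edge_form_eq:
  "s > t \<Longrightarrow> twisted_edge_form p c d s t = (\<bar>c\<bar> powr p * s - \<bar>d\<bar> powr p * t) * (s - t) powr (p - 1)"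
  using Phi_uminus[of p "s - t"] by (simp add: twisted_edge_form_def Phi_pos_eq algebra_simps)

text \<open>
  Write \<open>c\<close> as the convex combination \<open>(1 - t / s) u + (t / s) d\<close>; this forces
  \<open>u = (c s - d t) / (s - t)\<close>, and convexity bounds \<open>\<bar>c\<bar>\<^sup>p\<close>.
\<close>

lemma twisted_edge_form_le_ordered:
  assumes p: "p > 1" and st: "s > t" "t \<ge> 0"
  shows "twisted_edge_form p c d s t \<le> \<bar>c * s - d * t\<bar> powr p"
proof -
  define u where "u = (c * s - d * t) / (s - t)"
  have conv: "(1 - t / s) * u + t / s * d = c"
  proof -
    have "1 - t / s = (s - t) / s" using st by (simp add: field_simps)
    then show ?thesis using st by (simp add: u_def field_simps)
  qed
  have "\<bar>c\<bar> powr p \<le> (1 - t / s) * \<bar>u\<bar> powr p + t / s * \<bar>d\<bar> powr p"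
    using abs_powr_convex[of p "t / s" u d] p st unfolding conv by simp
  then have "s * \<bar>c\<bar> powr p \<le> s * ((1 - t / s) * \<bar>u\<bar> powr p + t / s * \<bar>d\<bar> powr p)"
    using st by (intro mult_left_mono) auto
  also have "\<dots> = (s - t) * \<bar>u\<bar> powr p + t * \<bar>d\<bar> powr p"
    using st by (simp add: field_simps)
  finally have "\<bar>c\<bar> powr p * s - \<bar>d\<bar> powr p * t \<le> (s - t) * \<bar>u\<bar> powr p"
    by (simp add: mult.commute)
  then have "twisted_edge_form p c d s t \<le> (s - t) * \<bar>u\<bar> powr p * (s - t) powr (p - 1)"
    unfolding twisted_edge_form_eq[OF st(1)] by (rule mult_right_mono) simp
  also have "\<dots> = (s - t) powr p * \<bar>u\<bar> powr p"
    using powr_mult_base[of "s - t" "p - 1"] st by (simp add: mult_ac)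
  also have "\<dots> = \<bar>c * s - d * t\<bar> powr p"
    using st by (simp add: u_def powr_divide)
  finally show ?thesis .
qed

text \<open>
  Exchanging the two ends and changing the sign of \<open>f\<close> reduce the case of equal signs to the ordered
  nonnegative one.  For \<open>c = d\<close> there is equality.
\<close>

lemma twisted_edge_form_le:
  assumes p: "p > 1" and cd: "c = d \<or> s * t \<ge> 0"
  shows "twisted_edge_form p c d s t \<le> \<bar>c * s - d * t\<bar> powr p"
proof (cases "c = d")
  case True
  have "twisted_edge_form p d d s t = \<bar>d\<bar> powr p * ((s - t) * Phi p (s - t))"
    using Phi_uminus[of p "s - t"] by (simp add: twisted_edge_form_def algebra_simps)
  also have "\<dots> = \<bar>d * s - d * t\<bar> powr p"
    by (simp add: mult_Phi abs_mult powr_mult flip: right_diff_distrib)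
  finally show ?thesis using True by simp
next
  case False
  have nonneg: "twisted_edge_form p c d s t \<le> \<bar>c * s - d * t\<bar> powr p"
    if "s \<ge> 0" "t \<ge> 0" for c d s t
  proof -
    consider "s > t" | "t > s" | "s = t" by linarith
    then show ?thesis
    proof cases
      case 1
      then show ?thesis using twisted_edge_form_le_ordered p that by blast
    next
      case 2
      have "twisted_edge_form p d c t s \<le> \<bar>d * t - c * s\<bar> powr p"
        using twisted_edge_form_le_ordered 2 p that by blast
      then show ?thesis by (simp add: twisted_edge_form_commute[of p c] abs_minus_commute)
    qed (simp add: twisted_edge_form_def Phi_def)
  qed
  from False cd have "s \<ge> 0 \<and> t \<ge> 0 \<or> - s \<ge> 0 \<and> - t \<ge> 0" by (auto simp: zero_le_mult_iff)
  then show ?thesis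
  proof
    assume "- s \<ge> 0 \<and> - t \<ge> 0"
    then show ?thesis
      using nonneg[of "- s" "- t" c d] by (simp add: twisted_edge_form_uminus abs_minus_commute)
  qed (simp add: nonneg)
qed

text \<open>
  When \<open>s\<close> and \<open>t\<close> have opposite signs, \<open>(c s - d t) / (s - t)\<close> is itself a convex combination of \<open>c\<close>
  and \<open>d\<close>, so convexity gives the reverse of the previous inequality.
\<close>

lemma twisted_edge_form_ge:
  assumes p: "p > 1" and st: "s * t < 0"
  shows "\<bar>c * s - d * t\<bar> powr p \<le> twisted_edge_form p c d s t"
proof -
  have ordered: "\<bar>c * s - d * t\<bar> powr p \<le> twisted_edge_form p c d s t"
    if st: "s > 0" "t < 0" for c d s t
  proof -
    define a where "a = - t / (s - t)"
    have a: "0 \<le> a" "a \<le> 1" "(s - t) * (1 - a) = s" "(s - t) * a = - t"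
      using st by (auto simp: a_def field_simps)
    have split: "(s - t) * ((1 - a) * x + a * y) = s * x - t * y" for x y
      by (simp only: distrib_left mult.assoc[symmetric] a)
    have "c * s - d * t = (s - t) * ((1 - a) * c + a * d)" unfolding split by (simp add: mult.commute)
    then have "\<bar>c * s - d * t\<bar> powr p = (s - t) powr p * \<bar>(1 - a) * c + a * d\<bar> powr p"
      using st by (simp add: abs_mult powr_mult)
    also have "\<dots> \<le> (s - t) powr p * ((1 - a) * \<bar>c\<bar> powr p + a * \<bar>d\<bar> powr p)"
      using p a by (intro mult_left_mono abs_powr_convex) auto
    also have "\<dots> = (s - t) powr (p - 1) * ((s - t) * ((1 - a) * \<bar>c\<bar> powr p + a * \<bar>d\<bar> powr p))"
      using powr_mult_base[of "s - t" "p - 1"] st by (simp add: mult_ac)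
    also have "(s - t) * ((1 - a) * \<bar>c\<bar> powr p + a * \<bar>d\<bar> powr p) = \<bar>c\<bar> powr p * s - \<bar>d\<bar> powr p * t"
      unfolding split by (simp add: mult.commute)
    finally show ?thesis using st by (simp add: twisted_edge_form_eq mult.commute)
  qed
  show ?thesis
  proof (cases "s > 0")
    case True
    then show ?thesis using ordered st by (simp add: mult_less_0_iff)
  next
    case False
    then have "t > 0" "s < 0" using st by (auto simp: mult_less_0_iff)
    then show ?thesis
      using ordered[of t s d c] by (simp add: twisted_edge_form_commute[of p c] abs_minus_commute)
  qed
qed

section \<open>Comparing the energy with an eigenvalue\<close>

lemma sum_over_adjacent_pairs:
  fixes F :: "'v::finite set \<Rightarrow> real"
  assumes "simple_graph E"
  shows "(\<Sum>x\<in>UNIV. \<Sum>y | {x, y} \<in> E. F {x, y}) = 2 * (\<Sum>e\<in>E. F e)"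
proof -
  let ?P = "{(x, y). {x, y} \<in> E}"
  have "(\<Sum>x\<in>UNIV. \<Sum>y | {x, y} \<in> E. F {x, y}) = (\<Sum>(x, y)\<in>?P. F {x, y})"
    by (subst sum.Sigma) (auto intro!: sum.cong)
  also have "\<dots> = (\<Sum>e\<in>E. \<Sum>(x, y)\<in>{q \<in> ?P. (case q of (x, y) \<Rightarrow> {x, y}) = e}. F {x, y})"
    by (rule sum.group[symmetric]) auto
  also have "\<dots> = (\<Sum>e\<in>E. 2 * F e)"
  proof (rule sum.cong)
    fix e assume e: "e \<in> E"
    then obtain a b where ab: "e = {a, b}" "a \<noteq> b"
      using assms by (auto simp: simple_graph_def card_2_iff)
    have "{q \<in> ?P. (case q of (x, y) \<Rightarrow> {x, y}) = e} = {(a, b), (b, a)}"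
      using e ab by (auto simp: doubleton_eq_iff insert_commute)
    then show "(\<Sum>(x, y)\<in>{q \<in> ?P. (case q of (x, y) \<Rightarrow> {x, y}) = e}. F {x, y}) = 2 * F e"
      using ab by (simp add: insert_commute)
  qed simp
  finally show ?thesis by (simp add: sum_distrib_left)
qed

lemma sum_adjacent_symmetrize:
  fixes A :: "'v::finite \<Rightarrow> 'v \<Rightarrow> real"
  shows "(\<Sum>x\<in>UNIV. \<Sum>y | {x, y} \<in> E. w {x, y} * (A x y + A y x))
    = 2 * (\<Sum>x\<in>UNIV. \<Sum>y | {x, y} \<in> E. w {x, y} * A x y)"
proof -
  have "(\<Sum>x\<in>UNIV. \<Sum>y | {x, y} \<in> E. w {x, y} * A y x)
      = (\<Sum>y\<in>UNIV. \<Sum>x | {x, y} \<in> E. w {x, y} * A y x)"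
    using sum.swap_restrict[of "UNIV :: 'v set" "UNIV :: 'v set" "\<lambda>x y. w {x, y} * A y x"
        "\<lambda>x y. {x, y} \<in> E"] by simp
  then show ?thesis
    by (simp add: distrib_left sum.distrib insert_commute)
qed

text \<open>
  The numerator of the Rayleigh quotient, with the sum over edges written as half the sum over ordered
  pairs of neighbours, which is the form in which the Laplacian enters.
\<close>

definition p_energy ::
  "real \<Rightarrow> 'v::finite set set \<Rightarrow> ('v set \<Rightarrow> real) \<Rightarrow> ('v \<Rightarrow> real) \<Rightarrow> real ^ 'v \<Rightarrow> real" where
  "p_energy p E w \<kappa> g =
     (\<Sum>x\<in>UNIV. \<Sum>y | {x, y} \<in> E. w {x, y} * \<bar>g $ x - g $ y\<bar> powr p) / 2
     + (\<Sum>x\<in>UNIV. \<kappa> x * \<bar>g $ x\<bar> powr p)"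

lemma rayleigh_eq:
  assumes "simple_graph E"
  shows "rayleigh p E w \<mu> \<kappa> g = p_energy p E w \<kappa> g / weighted_mass p \<mu> g"
  using sum_over_adjacent_pairs[OF assms, of "\<lambda>e. w e * edge_diff g e powr p"]
  by (simp add: rayleigh_def p_energy_def weighted_mass_def edge_diff_doubleton)

text \<open>
  The eigenvalue equation tested against \<open>\<bar>c x\<bar>\<^sup>p f x\<close>, with the double sum symmetrized.
\<close>

lemma eigenfunction_twisted_sum:
  assumes eig: "is_eigenfunction p E w \<mu> \<kappa> lam f"
  shows "(\<Sum>x\<in>UNIV. \<Sum>y | {x, y} \<in> E. w {x, y} * twisted_edge_form p (c x) (c y) (f $ x) (f $ y)) / 2
     + (\<Sum>x\<in>UNIV. \<kappa> x * \<bar>c x * f $ x\<bar> powr p) = lam * weighted_mass p \<mu> (\<chi> x. c x * f $ x)"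
proof -
  define A where "A x y = \<bar>c x\<bar> powr p * f $ x * Phi p (f $ x - f $ y)" for x y
  have loc: "\<bar>c x\<bar> powr p * (f $ x * Phi p (f $ x)) = \<bar>c x * f $ x\<bar> powr p" for x
    by (simp add: mult_Phi abs_mult powr_mult)
  have "lam * weighted_mass p \<mu> (\<chi> x. c x * f $ x)
    = (\<Sum>x\<in>UNIV. \<bar>c x\<bar> powr p * f $ x * (lam * \<mu> x * Phi p (f $ x)))"
    by (simp add: weighted_mass_def sum_distrib_left flip: loc) (simp add: mult_ac)
  also have "\<dots> = (\<Sum>x\<in>UNIV. \<bar>c x\<bar> powr p * f $ x * p_laplacian p E w \<kappa> f x)"
    using eig by (simp add: is_eigenfunction_def)
  also have "\<dots> = (\<Sum>x\<in>UNIV. \<Sum>y | {x, y} \<in> E. w {x, y} * A x y)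
      + (\<Sum>x\<in>UNIV. \<kappa> x * \<bar>c x * f $ x\<bar> powr p)"
    by (simp add: p_laplacian_def A_def distrib_left sum_distrib_left sum.distrib mult_ac flip: loc)
  also have "(\<Sum>x\<in>UNIV. \<Sum>y | {x, y} \<in> E. w {x, y} * A x y)
    = (\<Sum>x\<in>UNIV. \<Sum>y | {x, y} \<in> E. w {x, y} * twisted_edge_form p (c x) (c y) (f $ x) (f $ y)) / 2"
    using sum_adjacent_symmetrize[of w A E] by (simp add: twisted_edge_form_def A_def)
  finally show ?thesis by simp
qed

text \<open>
  For \<open>c\<close> constant on the parts of a partition of the vertices, the hypothesis restricts only the edges
  between different parts.
\<close>

lemma eigenvalue_le_energy_of_twist:
  assumes "p > 1" and w: "\<And>e. e \<in> E \<Longrightarrow> w e > 0"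
    and eig: "is_eigenfunction p E w \<mu> \<kappa> lam f"
    and c: "\<And>x y. {x, y} \<in> E \<Longrightarrow> c x = c y \<or> f $ x * f $ y \<ge> 0"
  shows "lam * weighted_mass p \<mu> (\<chi> x. c x * f $ x) \<le> p_energy p E w \<kappa> (\<chi> x. c x * f $ x)"
proof -
  have "(\<Sum>x\<in>UNIV. \<Sum>y | {x, y} \<in> E. w {x, y} * twisted_edge_form p (c x) (c y) (f $ x) (f $ y))
    \<le> (\<Sum>x\<in>UNIV. \<Sum>y | {x, y} \<in> E. w {x, y} * \<bar>c x * f $ x - c y * f $ y\<bar> powr p)"
    using w c assms(1) by (intro sum_mono mult_left_mono twisted_edge_form_le) (auto simp: less_imp_le)
  then show ?thesis
    unfolding eigenfunction_twisted_sum[OF eig, of c, symmetric] by (simp add: p_energy_def)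
qed

text \<open>
  As \<open>f\<close> has no zeros, every \<open>g\<close> is \<open>c f\<close> for some \<open>c\<close>.
\<close>

lemma energy_le_eigenvalue_of_alternating:
  assumes "p > 1" and w: "\<And>e. e \<in> E \<Longrightarrow> w e > 0"
    and eig: "is_eigenfunction p E w \<mu> \<kappa> lam f"
    and nz: "\<And>x. f $ x \<noteq> 0"
    and alt: "\<And>x y. {x, y} \<in> E \<Longrightarrow> f $ x * f $ y < 0"
  shows "p_energy p E w \<kappa> g \<le> lam * weighted_mass p \<mu> g"
proof -
  define c where "c x = g $ x / f $ x" for x
  have cf: "c x * f $ x = g $ x" for x using nz by (simp add: c_def)
  have "(\<Sum>x\<in>UNIV. \<Sum>y | {x, y} \<in> E. w {x, y} * \<bar>c x * f $ x - c y * f $ y\<bar> powr p)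
    \<le> (\<Sum>x\<in>UNIV. \<Sum>y | {x, y} \<in> E. w {x, y} * twisted_edge_form p (c x) (c y) (f $ x) (f $ y))"
    using w alt assms(1) by (intro sum_mono mult_left_mono twisted_edge_form_ge) (auto simp: less_imp_le)
  then show ?thesis
    using eigenfunction_twisted_sum[OF eig, of c] by (simp add: p_energy_def cf)
qed

text \<open>
  At a zero of \<open>f\<close> the eigenvalue equation says that a sum over the neighbours vanishes.  All its
  terms have the same sign, so \<open>f\<close> vanishes at the neighbours too, and by connectedness everywhere.
\<close>

lemma sgn_alternating_eigenfunction_nonzero:
  fixes f :: "real ^ 'v::finite" and s :: "'v \<Rightarrow> real"
  assumes conn: "connected_graph E" and w: "\<And>e. e \<in> E \<Longrightarrow> w e > 0"
    and eig: "is_eigenfunction p E w \<mu> \<kappa> lam f"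
    and s: "\<And>x. s x \<noteq> 0" "\<And>x y. {x, y} \<in> E \<Longrightarrow> s y = - s x"
    and sf: "\<And>x. s x * f $ x \<ge> 0"
  shows "f $ x \<noteq> 0"
proof
  assume x: "f $ x = 0"
  have step: "f $ y = 0" if fu: "f $ u = 0" and uy: "{u, y} \<in> E" for u y
  proof -
    let ?t = "\<lambda>z. w {u, z} * (s u * Phi p (- f $ z))"
    have "(\<Sum>z | {u, z} \<in> E. w {u, z} * Phi p (- f $ z)) = p_laplacian p E w \<kappa> f u"
      by (simp add: p_laplacian_def fu Phi_def)
    also have "\<dots> = 0" using eig fu by (simp add: is_eigenfunction_def Phi_def)
    finally have "(\<Sum>z | {u, z} \<in> E. ?t z) = 0"
      by (simp add: mult.left_commute[of _ "s u"] flip: sum_distrib_left)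
    moreover have "?t z \<ge> 0" if "{u, z} \<in> E" for z
    proof -
      have "s u * Phi p (- f $ z) = \<bar>f $ z\<bar> powr (p - 2) * (s z * f $ z)"
        using s(2)[OF that] by (simp add: Phi_def)
      then show ?thesis using sf[of z] w[OF that] by simp
    qed
    ultimately have "?t y = 0" using uy by (subst (asm) sum_nonneg_eq_0_iff) auto
    then have "Phi p (- f $ y) = 0" using w[OF uy] s(1)[of u] by simp
    then show ?thesis by (simp add: Phi_def split: if_splits)
  qed
  have "f $ y = 0" for y
  proof -
    have "(x, y) \<in> {(u, v). {u, v} \<in> E}\<^sup>*" using conn by (simp add: connected_graph_def)
    then show ?thesis by (induction rule: rtrancl_induct) (use x step in auto)
  qed
  then show False using eig by (simp add: is_eigenfunction_def vec_eq_iff)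
qed

section \<open>Bounds for variational eigenvalues\<close>

text \<open>
  The functions in question form a plane, and the value at \<open>x1\<close> and at \<open>x2\<close> determines which of them
  agrees with a given \<open>g\<close> there.  Subtracting it projects along the plane onto the functions that
  vanish at \<open>x1\<close> and \<open>x2\<close>, a space of dimension \<open>k\<close>.
\<close>

lemma subspace_of_sign_twists_meets_admissible:
  fixes f :: "real ^ 'v::finite" and Q :: "'v \<Rightarrow> bool"
  assumes n: "CARD('v) = k + 2" and A: "A \<in> admissible (Suc k) p \<mu>"
    and x1: "f $ x1 \<noteq> 0" "Q x1" and x2: "f $ x2 \<noteq> 0" "\<not> Q x2"
  shows "\<exists>a b. (\<chi> x. (if Q x then a else b) * f $ x) \<in> A"
proof -
  have "x1 \<noteq> x2" using x1 x2 by auto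
  then have "card (UNIV - {x1, x2}) = k" using n by (simp add: card_Diff_subset)
  then obtain b where b: "bij_betw b {0..<k} (UNIV - {x1, x2})"
    using ex_bij_betw_nat_finite[of "UNIV - {x1, x2}"] by auto
  define a1 a2 where "a1 g = g $ x1 / f $ x1" and "a2 g = g $ x2 / f $ x2" for g
  \<comment> \<open>the projection, with the remaining \<open>k\<close> vertices numbered by \<open>b\<close>\<close>
  define h where "h g i = (if i < k
      then g $ b i - (if Q (b i) then a1 g else a2 g) * f $ b i else 0)" for g i
  have "\<exists>g\<in>A. h g = (\<lambda>i. 0)"
  proof (rule zero_of_odd_map_below_genus)
    show "enat (Suc k) \<le> genus A" using A by (simp add: admissible_def)
    show "continuous_on A (\<lambda>g. h g i)" for i
      unfolding h_def a1_def a2_def using x1 x2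
      by (cases "i < k"; cases "Q (b i)") (auto intro!: continuous_intros)
    show "h (- g) = (\<lambda>i. - h g i)" for g
      by (auto simp: h_def a1_def a2_def fun_eq_iff)
    show "h g i = 0" if "k \<le> i" for g i using that by (simp add: h_def)
  qed
  then obtain g where g: "g \<in> A" "\<And>i. h g i = 0" by metis
  have "g $ x = (if Q x then a1 g else a2 g) * f $ x" for x
  proof (cases "x \<in> {x1, x2}")
    case True
    then show ?thesis using x1 x2 by (auto simp: a1_def a2_def)
  next
    case False
    then have "x \<in> b ` {0..<k}" using b by (simp add: bij_betw_def)
    then obtain i where "i < k" "x = b i" by auto
    then show ?thesis using g(2)[of i] by (simp add: h_def)
  qed
  then have "g = (\<chi> x. (if Q x then a1 g else a2 g) * f $ x)" by (simp add: vec_eq_iff)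
  then show ?thesis using g(1) by metis
qed

lemma continuous_on_p_energy:
  "p > 0 \<Longrightarrow> continuous_on S (p_energy p E w \<kappa>)"
  unfolding p_energy_def
  by (intro continuous_intros continuous_on_abs_powr continuous_on_powr') auto

context
  fixes E :: "'v::finite set set" and w :: "'v set \<Rightarrow> real" and \<mu> \<kappa> :: "'v \<Rightarrow> real" and p :: real
  assumes simple: "simple_graph E" and w: "\<And>e. e \<in> E \<Longrightarrow> w e > 0"
    and \<mu>: "\<And>x. \<mu> x > 0" and p: "p > 1"
begin

lemma rayleigh_on_p_sphere: "f \<in> p_sphere p \<mu> \<Longrightarrow> rayleigh p E w \<mu> \<kappa> f = p_energy p E w \<kappa> f"
  using rayleigh_eq[OF simple] by (simp add: p_sphere_iff)

lemma bounded_rayleigh: "bounded (rayleigh p E w \<mu> \<kappa> ` p_sphere p \<mu>)"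
proof -
  have "compact (p_energy p E w \<kappa> ` p_sphere p \<mu>)"
    using p \<mu> by (intro compact_continuous_image continuous_on_p_energy compact_p_sphere) auto
  moreover have "rayleigh p E w \<mu> \<kappa> ` p_sphere p \<mu> = p_energy p E w \<kappa> ` p_sphere p \<mu>"
    by (rule image_cong) (simp_all add: rayleigh_on_p_sphere)
  ultimately show ?thesis using compact_imp_bounded by simp
qed

lemma rayleigh_le_SUP:
  assumes "A \<subseteq> p_sphere p \<mu>" "f \<in> A"
  shows "rayleigh p E w \<mu> \<kappa> f \<le> (SUP f\<in>A. rayleigh p E w \<mu> \<kappa> f)"
  using assms bounded_rayleigh
  by (intro cSUP_upper bounded_imp_bdd_above) (auto intro: bounded_subset)

text \<open>
  The infimum is bounded below by \<open>lam\<close> only because it is taken over a nonempty family: the sphere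
  belongs to it.
\<close>

lemma le_variational_eigenvalue:
  assumes "k \<le> CARD('v)"
    and "\<And>A. A \<in> admissible k p \<mu> \<Longrightarrow> \<exists>f\<in>A. rayleigh p E w \<mu> \<kappa> f \<ge> lam"
  shows "lam \<le> variational_eigenvalue p E w \<mu> \<kappa> k"
  unfolding variational_eigenvalue_def
proof (rule cINF_greatest)
  show "admissible k p \<mu> \<noteq> {}" using p_sphere_admissible[of p \<mu> k] p \<mu> assms(1) by auto
  fix A assume A: "A \<in> admissible k p \<mu>"
  then obtain f where f: "f \<in> A" "rayleigh p E w \<mu> \<kappa> f \<ge> lam" using assms(2) by blast
  moreover have "A \<subseteq> p_sphere p \<mu>" using A by (simp add: admissible_def)
  ultimately show "lam \<le> (SUP f\<in>A. rayleigh p E w \<mu> \<kappa> f)"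
    using rayleigh_le_SUP order_trans by blast
qed

lemma variational_eigenvalue_le:
  assumes "1 \<le> k" "k \<le> CARD('v)"
    and le: "\<And>f. f \<in> p_sphere p \<mu> \<Longrightarrow> rayleigh p E w \<mu> \<kappa> f \<le> lam"
  shows "variational_eigenvalue p E w \<mu> \<kappa> k \<le> lam"
proof -
  have ne: "A \<noteq> {}" if "A \<in> admissible k p \<mu>" for A
    using that assms(1) by (auto simp: admissible_def genus_def zero_enat_def)
  have adm: "p_sphere p \<mu> \<in> admissible k p \<mu>" using p_sphere_admissible[of p \<mu> k] p \<mu> assms(2) by auto
  obtain m where m: "\<And>f. f \<in> p_sphere p \<mu> \<Longrightarrow> m \<le> rayleigh p E w \<mu> \<kappa> f"
    using bounded_imp_bdd_below[OF bounded_rayleigh] by (auto simp: bdd_below_def)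
  have "bdd_below ((\<lambda>S. SUP f\<in>S. rayleigh p E w \<mu> \<kappa> f) ` admissible k p \<mu>)"
  proof (rule bdd_belowI2)
    fix A assume A: "A \<in> admissible k p \<mu>"
    then obtain f where "f \<in> A" using ne by blast
    moreover have "A \<subseteq> p_sphere p \<mu>" using A by (simp add: admissible_def)
    ultimately show "m \<le> (SUP f\<in>A. rayleigh p E w \<mu> \<kappa> f)"
      using rayleigh_le_SUP[of A f] m[of f] by force
  qed
  then have "variational_eigenvalue p E w \<mu> \<kappa> k \<le> (SUP f\<in>p_sphere p \<mu>. rayleigh p E w \<mu> \<kappa> f)"
    unfolding variational_eigenvalue_def using adm by (rule cINF_lower)
  also have "\<dots> \<le> lam" using ne[OF adm] le by (rule cSUP_least)
  finally show ?thesis .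
qed

end

section \<open>The gap below the largest variational eigenvalue\<close>

theorem corollary5p1:
  fixes E :: "'v::finite set set"
    and w :: "'v set \<Rightarrow> real"
    and \<mu> \<kappa> :: "'v \<Rightarrow> real"
    and p :: real
  assumes "simple_graph E"
    and "connected_graph E"
    and "bipartite_graph E"
    and "CARD('v) \<ge> 2"
    and "\<And>e. e \<in> E \<Longrightarrow> w e > 0"
    and "\<And>x. \<mu> x > 0"
    and "p > 1"
  shows "\<not> (\<exists>lam. is_eigenvalue p E w \<mu> \<kappa> lam \<and>
               variational_eigenvalue p E w \<mu> \<kappa> (CARD('v) - 1) < lam \<and>
               lam < variational_eigenvalue p E w \<mu> \<kappa> (CARD('v)))"
proof -
  have "lam \<le> variational_eigenvalue p E w \<mu> \<kappa> (CARD('v) - 1) \<or>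
        variational_eigenvalue p E w \<mu> \<kappa> (CARD('v)) \<le> lam" if lam: "is_eigenvalue p E w \<mu> \<kappa> lam" for lam
  proof -
    obtain f where eig: "is_eigenfunction p E w \<mu> \<kappa> lam f"
      using lam by (auto simp: is_eigenvalue_def)
    obtain A B where AB: "A \<union> B = UNIV" "A \<inter> B = {}" "\<And>e. e \<in> E \<Longrightarrow> \<exists>a\<in>A. \<exists>b\<in>B. e = {a, b}"
      using assms(3) by (auto simp: bipartite_graph_def)
    \<comment> \<open>the sign that changes along every edge\<close>
    define \<sigma> :: "'v \<Rightarrow> real" where "\<sigma> x = (if x \<in> A then 1 else - 1)" for x
    have \<sigma>: "\<sigma> x \<noteq> 0" for x by (simp add: \<sigma>_def)
    have \<sigma>_edge: "\<sigma> y = - \<sigma> x" if "{x, y} \<in> E" for x y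
      using AB(2) AB(3)[OF that] by (auto simp: \<sigma>_def doubleton_eq_iff)
    have ff: "f $ x * f $ y = - (\<sigma> x * f $ x) * (\<sigma> y * f $ y)" if "{x, y} \<in> E" for x y
      using \<sigma>_edge[OF that] by (auto simp: \<sigma>_def split: if_splits)
    show ?thesis
    proof (cases "(\<exists>x. \<sigma> x * f $ x > 0) \<and> (\<exists>x. \<sigma> x * f $ x < 0)")
      case True
      then obtain x1 x2 where x1: "\<sigma> x1 * f $ x1 > 0" and x2: "\<sigma> x2 * f $ x2 < 0" by blast
      obtain k where k: "CARD('v) = k + 2"
        using assms(4) by (metis add.commute le_Suc_ex)
      have "lam \<le> variational_eigenvalue p E w \<mu> \<kappa> (CARD('v) - 1)"
      proof (rule le_variational_eigenvalue[OF assms(1,5,6,7)])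
        fix S assume S: "S \<in> admissible (CARD('v) - 1) p \<mu>"
        let ?g = "\<lambda>a b. \<chi> x. (if \<sigma> x * f $ x > 0 then a else b) * f $ x"
        have "S \<in> admissible (Suc k) p \<mu>" "f $ x1 \<noteq> 0" "f $ x2 \<noteq> 0" "\<not> \<sigma> x2 * f $ x2 > 0"
          using S k x1 x2 by auto
        then obtain a b where ab: "?g a b \<in> S"
          using subspace_of_sign_twists_meets_admissible[OF k, of S p \<mu> f x1 "\<lambda>x. \<sigma> x * f $ x > 0" x2] x1
          by blast
        have "lam * weighted_mass p \<mu> (?g a b) \<le> p_energy p E w \<kappa> (?g a b)"
        proof (rule eigenvalue_le_energy_of_twist[OF assms(7,5) eig])
          fix x y assume xy: "{x, y} \<in> E"
          show "(if \<sigma> x * f $ x > 0 then a else b) = (if \<sigma> y * f $ y > 0 then a else b)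
              \<or> f $ x * f $ y \<ge> 0"
          proof (cases "\<sigma> x * f $ x > 0 \<longleftrightarrow> \<sigma> y * f $ y > 0")
            case False
            then have "(\<sigma> x * f $ x) * (\<sigma> y * f $ y) \<le> 0"
              by (metis mult_nonneg_nonpos mult_nonpos_nonneg not_less less_imp_le)
            then show ?thesis using ff[OF xy] by simp
          qed simp
        qed
        moreover have "?g a b \<in> p_sphere p \<mu>" using ab S by (auto simp: admissible_def)
        ultimately have "lam \<le> rayleigh p E w \<mu> \<kappa> (?g a b)"
          using rayleigh_on_p_sphere[OF assms(1,5,6,7)] by (simp add: p_sphere_iff)
        then show "\<exists>g\<in>S. lam \<le> rayleigh p E w \<mu> \<kappa> g" using ab by blast
      qed auto
      then show ?thesis ..
    next
      case False
      \<comment> \<open>After replacing \<open>\<sigma>\<close> by its negative if necessary, \<open>\<sigma> f\<close> is nonnegative.\<close>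
      have "\<exists>s :: 'v \<Rightarrow> real. (\<forall>x. s x \<noteq> 0) \<and> (\<forall>x y. {x, y} \<in> E \<longrightarrow> s y = - s x) \<and> (\<forall>x. s x * f $ x \<ge> 0)"
      proof (cases "\<exists>x. \<sigma> x * f $ x < 0")
        case True
        then show ?thesis
          using False \<sigma> \<sigma>_edge by (intro exI[of _ "\<lambda>x. - \<sigma> x"]) (auto simp: not_less)
      next
        case False
        then show ?thesis using \<sigma> \<sigma>_edge by (intro exI[of _ \<sigma>]) (auto simp: not_less)
      qed
      then obtain s :: "'v \<Rightarrow> real" where s: "\<And>x. s x \<noteq> 0" "\<And>x y. {x, y} \<in> E \<Longrightarrow> s y = - s x"
        "\<And>x. s x * f $ x \<ge> 0" by blast
      have nz: "f $ x \<noteq> 0" for x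
        by (rule sgn_alternating_eigenfunction_nonzero[OF assms(2,5) eig s])
      have alt: "f $ x * f $ y < 0" if "{x, y} \<in> E" for x y
      proof -
        have "s x * f $ x > 0" "s y * f $ y > 0" using s(1,3) nz by (simp_all add: less_le)
        then have "0 < s x * f $ x * (s y * f $ y)" by simp
        also have "\<dots> = - (s x)\<^sup>2 * (f $ x * f $ y)" using s(2)[OF that] by (simp add: power2_eq_square)
        finally show ?thesis by (simp add: mult_less_0_iff zero_less_mult_iff)
      qed
      have "variational_eigenvalue p E w \<mu> \<kappa> (CARD('v)) \<le> lam"
      proof (rule variational_eigenvalue_le[OF assms(1,5,6,7)])
        fix g assume g: "g \<in> p_sphere p \<mu>"
        show "rayleigh p E w \<mu> \<kappa> g \<le> lam"
          using energy_le_eigenvalue_of_alternating[OF assms(7,5) eig nz alt, of g] g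
            rayleigh_on_p_sphere[OF assms(1,5,6,7) g] by (simp add: p_sphere_iff)
      qed (use assms(4) in auto)
      then show ?thesis ..
    qed
  qed
  then show ?thesis by (meson not_le)
qed

end
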